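(* In the deterministic optimal control problem under a parameterized policy, let $\pi=(\theta_0^*,\dots,\theta_{n-1}^* )\in\Theta^n$ be a local minimizer of DP. Then $\pi$ is also a local minimizer of the one-shot optimization.
   Context: Setting (deterministic, parameterized policy): horizon $n$, states in $\mathbb{R}^N$, compact action space $A\subseteq\mathbb{R}^M$, dynamics $f_k:\mathbb{R}^N\times\mathbb{R}^M\to\mathbb{R}^N$ and stage costs $c_k:\mathbb{R}^N\times\mathbb{R}^M\to\mathbb{R}$ ($k=0,\dots,n-1$), terminal cost $c_n:\mathbb{R}^N\to\mathbb{R}$, all at least twice continuously differentiable; the initial state $x_0$ is given. $\Theta$ is a parameter space (a subset of a Euclidean space), and for each $\theta\in\Theta$, $\mu_\theta:\mathbb{R}^N\to A$ is a bounded function, such that for all $\epsilon>0$ there is $\delta>0$ with: $\|\theta-\theta'\|<\delta\Rightarrow\sup_{x\in\mathbb{R}^N}\|\mu_\theta(x)-\mu_{\theta'}(x)\|<\epsilon$. $B(c,r)$ denotes the open ball with center $c$ and radius $r$. For a control policy parameter vector $\pi=(\theta_0,\dots,\theta_{n-1})\in\Theta^n$, define backward $J_n^\pi(x)=c_n(x)$, $Q_k^\pi(x,u)=c_k(x,u)+J_{k+1}^\pi(f_k(x,u))$, $J_k^\pi(x)=Q_k^\pi(x,\mu_{\theta_k}(x))$, $k=n-1,\dots,0$. The one-shot optimization is $\min_{\pi\in\Theta^n}J_0^\pi(x_0)$. Local minimizer of the one-shot optimization: $\pi=(\theta_0^*,\dots,\theta_{n-1}^* )\in\Theta^n$ such that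 for some $\epsilon>0$, $J_0^\pi(x_0)\le J_0^{\tilde\pi}(x_0)$ for all $\tilde\pi\in(B(\theta_0^*,\epsilon)\cap\Theta)\times\dots\times(B(\theta_{n-1}^*,\epsilon)\cap\Theta)$. Local minimizer of DP: $\pi=(\theta_0^*,\dots,\theta_{n-1}^* )\in\Theta^n$ such that for every $k\in\{0,\dots,n-1\}$ there is $\epsilon_k^*>0$ (independent of $x$) with $Q_k^\pi(x,\mu_{\theta_k^*}(x))\le Q_k^\pi(x,\mu_{\tilde\theta}(x))$ for all $x\in\mathbb{R}^N$ and all $\tilde\theta\in B(\theta_k^*,\epsilon_k^* )\cap\Theta$. *)

theory Defs
  imports "HOL-Analysis.Analysis"
begin

text \<open>
  \<open>C\<^sup>2\<close> on the whole space: the Frechet derivative and the second Frechet derivative exist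
  everywhere as maps into the spaces of bounded linear functions, and the latter is continuous.
\<close>

definition twice_continuously_differentiable ::
  "('a::real_normed_vector \<Rightarrow> 'b::real_normed_vector) \<Rightarrow> bool" where
  "twice_continuously_differentiable g \<longleftrightarrow>
     (\<exists>(g' :: 'a \<Rightarrow> 'a \<Rightarrow>\<^sub>L 'b) (g'' :: 'a \<Rightarrow> 'a \<Rightarrow>\<^sub>L ('a \<Rightarrow>\<^sub>L 'b)).
        (\<forall>x. (g has_derivative blinfun_apply (g' x)) (at x)) \<and>
        (\<forall>x. (g' has_derivative blinfun_apply (g'' x)) (at x)) \<and>
        continuous_on UNIV g'')"

text \<open>
  Throughout, \<open>n\<close> is the horizon, \<open>f k\<close> and \<open>c k\<close> (for \<open>k < n\<close>) are the dynamics and stage costs,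
  \<open>cT\<close> is the terminal cost \<open>c\<^sub>n\<close>, and a policy parameter vector \<open>\<pi>\<close> in \<open>\<Theta>\<^sup>n\<close> is an element of the
  extensional function space \<open>{..<n} \<rightarrow>\<^sub>E \<Theta>\<close>.  The recursion below runs backward from stage \<open>n\<close>;
  values at indices \<open>k > n\<close> are never used.
\<close>

function cost_to_go ::
  "nat \<Rightarrow> (nat \<Rightarrow> 'x \<Rightarrow> 'u \<Rightarrow> 'x) \<Rightarrow> (nat \<Rightarrow> 'x \<Rightarrow> 'u \<Rightarrow> real) \<Rightarrow> ('x \<Rightarrow> real) \<Rightarrow>
   ('p \<Rightarrow> 'x \<Rightarrow> 'u) \<Rightarrow> (nat \<Rightarrow> 'p) \<Rightarrow> nat \<Rightarrow> 'x \<Rightarrow> real" where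
  "cost_to_go n f c cT \<mu> \<pi> k x =
     (if k < n
      then c k x (\<mu> (\<pi> k) x) + cost_to_go n f c cT \<mu> \<pi> (Suc k) (f k x (\<mu> (\<pi> k) x))
      else cT x)"
  by pat_completeness auto
termination
  by (relation "Wellfounded.measure (\<lambda>(n, f, c, cT, \<mu>, \<pi>, k, x). n - k)") auto

declare cost_to_go.simps [simp del]

definition Q_value ::
  "nat \<Rightarrow> (nat \<Rightarrow> 'x \<Rightarrow> 'u \<Rightarrow> 'x) \<Rightarrow> (nat \<Rightarrow> 'x \<Rightarrow> 'u \<Rightarrow> real) \<Rightarrow> ('x \<Rightarrow> real) \<Rightarrow>
   ('p \<Rightarrow> 'x \<Rightarrow> 'u) \<Rightarrow> (nat \<Rightarrow> 'p) \<Rightarrow> nat \<Rightarrow> 'x \<Rightarrow> 'u \<Rightarrow> real" where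
  "Q_value n f c cT \<mu> \<pi> k x u = c k x u + cost_to_go n f c cT \<mu> \<pi> (Suc k) (f k x u)"

lemma cost_to_go_terminal: "cost_to_go n f c cT \<mu> \<pi> n x = cT x"
  by (simp add: cost_to_go.simps)

lemma cost_to_go_eq_Q_value:
  "k < n \<Longrightarrow> cost_to_go n f c cT \<mu> \<pi> k x = Q_value n f c cT \<mu> \<pi> k x (\<mu> (\<pi> k) x)"
  by (simp add: cost_to_go.simps [of n f c cT \<mu> \<pi> k x] Q_value_def)

definition local_minimizer_one_shot ::
  "nat \<Rightarrow> (nat \<Rightarrow> 'x \<Rightarrow> 'u \<Rightarrow> 'x) \<Rightarrow> (nat \<Rightarrow> 'x \<Rightarrow> 'u \<Rightarrow> real) \<Rightarrow> ('x \<Rightarrow> real) \<Rightarrow>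
   'p::metric_space set \<Rightarrow> ('p \<Rightarrow> 'x \<Rightarrow> 'u) \<Rightarrow> 'x \<Rightarrow> (nat \<Rightarrow> 'p) \<Rightarrow> bool" where
  "local_minimizer_one_shot n f c cT \<Theta> \<mu> x0 \<pi> \<longleftrightarrow>
     \<pi> \<in> {..<n} \<rightarrow>\<^sub>E \<Theta> \<and>
     (\<exists>\<epsilon>>0. \<forall>\<pi>' \<in> (\<Pi>\<^sub>E k\<in>{..<n}. ball (\<pi> k) \<epsilon> \<inter> \<Theta>).
        cost_to_go n f c cT \<mu> \<pi> 0 x0 \<le> cost_to_go n f c cT \<mu> \<pi>' 0 x0)"

definition local_minimizer_DP ::
  "nat \<Rightarrow> (nat \<Rightarrow> 'x \<Rightarrow> 'u \<Rightarrow> 'x) \<Rightarrow> (nat \<Rightarrow> 'x \<Rightarrow> 'u \<Rightarrow> real) \<Rightarrow> ('x \<Rightarrow> real) \<Rightarrow>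
   'p::metric_space set \<Rightarrow> ('p \<Rightarrow> 'x \<Rightarrow> 'u) \<Rightarrow> (nat \<Rightarrow> 'p) \<Rightarrow> bool" where
  "local_minimizer_DP n f c cT \<Theta> \<mu> \<pi> \<longleftrightarrow>
     \<pi> \<in> {..<n} \<rightarrow>\<^sub>E \<Theta> \<and>
     (\<forall>k<n. \<exists>\<epsilon>>0. \<forall>x. \<forall>\<theta> \<in> ball (\<pi> k) \<epsilon> \<inter> \<Theta>.
        Q_value n f c cT \<mu> \<pi> k x (\<mu> (\<pi> k) x) \<le> Q_value n f c cT \<mu> \<pi> k x (\<mu> \<theta> x))"

end

theory Submission
  imports Defs
begin

text \<open>
  A DP local minimizer is locally optimal at every state with a radius independent of the state,
  so all stages can share the smallest radius. Backward induction then
  compares the two costs-to-go at every state: perturbing the parameter of the current stage cannot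
  decrease the Q-value of the minimizer, and replacing its tail by the perturbed tail cannot
  decrease the cost from the next state.
\<close>

text \<open>The hypothesis changes only the control of one stage and keeps the tail of
  \<open>\<pi>\<close>. Since the two policies may visit different states, it is assumed at every
  state rather than along one trajectory.\<close>

lemma cost_to_go_mono_policy:
  assumes "\<And>k x. k < n \<Longrightarrow>
      Q_value n f c cT \<mu> \<pi> k x (\<mu> (\<pi> k) x) \<le> Q_value n f c cT \<mu> \<pi> k x (\<mu> (\<pi>' k) x)"
    and "k \<le> n"
  shows "cost_to_go n f c cT \<mu> \<pi> k x \<le> cost_to_go n f c cT \<mu> \<pi>' k x"
  using \<open>k \<le> n\<close>
\<comment> \<open>Descending from \<open>n\<close>; \<open>x\<close> stays arbitrary because the
  induction hypothesis is applied at the successor state.\<close>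
proof (induction k arbitrary: x rule: inc_induct)
  case base
  show ?case by (simp add: cost_to_go_terminal)
next
  case (step k)
  have "cost_to_go n f c cT \<mu> \<pi> k x \<le> Q_value n f c cT \<mu> \<pi> k x (\<mu> (\<pi>' k) x)"
    using assms(1) step.hyps by (simp add: cost_to_go_eq_Q_value)
  \<comment> \<open>Both sides share the stage cost and the successor state reached by the perturbed
    control; only the tails differ.\<close>
  also have "\<dots> \<le> Q_value n f c cT \<mu> \<pi>' k x (\<mu> (\<pi>' k) x)"
    unfolding Q_value_def using step.IH by simp
  also have "\<dots> = cost_to_go n f c cT \<mu> \<pi>' k x"
    using step.hyps by (simp add: cost_to_go_eq_Q_value)
  finally show ?case .
qed

text \<open>One-shot minimality asks for a single radius, while DP minimality gives one per stage;
  finitely many positive radii have a positive minimum.\<close>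

lemma local_minimizer_DP_uniform_radius:
  assumes "local_minimizer_DP n f c cT \<Theta> \<mu> \<pi>"
  obtains \<epsilon> where "\<epsilon> > 0"
    and "\<And>k x \<theta>. k < n \<Longrightarrow> \<theta> \<in> ball (\<pi> k) \<epsilon> \<inter> \<Theta> \<Longrightarrow>
      Q_value n f c cT \<mu> \<pi> k x (\<mu> (\<pi> k) x) \<le> Q_value n f c cT \<mu> \<pi> k x (\<mu> \<theta> x)"
proof -
  \<comment> \<open>Each DP radius is fixed before \<open>x\<close>, so the choice function
    \<open>e\<close> depends on the stage only.\<close>
  obtain e where e: "\<And>k. k < n \<Longrightarrow> e k > (0::real)"
    "\<And>k x \<theta>. k < n \<Longrightarrow> \<theta> \<in> ball (\<pi> k) (e k) \<inter> \<Theta> \<Longrightarrow>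
      Q_value n f c cT \<mu> \<pi> k x (\<mu> (\<pi> k) x) \<le> Q_value n f c cT \<mu> \<pi> k x (\<mu> \<theta> x)"
    using assms unfolding local_minimizer_DP_def by metis
  \<comment> \<open>Inserting \<open>1\<close> keeps the set nonempty when \<open>n = 0\<close>; any
    positive number would do.\<close>
  define \<epsilon> where "\<epsilon> = Min (insert 1 (e ` {..<n}))"
  have "\<epsilon> > 0"
    using e(1) by (simp add: \<epsilon>_def)
  have "\<epsilon> \<le> e k" if "k < n" for k
    using that by (simp add: \<epsilon>_def)
  then have "ball (\<pi> k) \<epsilon> \<subseteq> ball (\<pi> k) (e k)" if "k < n" for k
    using that by (simp add: subset_ball)
  with e(2) \<open>\<epsilon> > 0\<close> show ?thesis
    by (intro that) blast+
qed

theorem theorem4: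
  fixes n :: nat
    and A :: "(real ^ 'M) set"
    and f :: "nat \<Rightarrow> real ^ 'N \<Rightarrow> real ^ 'M \<Rightarrow> real ^ 'N"
    and c :: "nat \<Rightarrow> real ^ 'N \<Rightarrow> real ^ 'M \<Rightarrow> real"
    and cT :: "real ^ 'N \<Rightarrow> real"
    and \<Theta> :: "'p::euclidean_space set"
    and \<mu> :: "'p \<Rightarrow> real ^ 'N \<Rightarrow> real ^ 'M"
    and x0 :: "real ^ 'N"
    and \<pi> :: "nat \<Rightarrow> 'p"
  assumes "compact A"
    and "\<And>k. k < n \<Longrightarrow> twice_continuously_differentiable (\<lambda>(x, u). f k x u)"
    and "\<And>k. k < n \<Longrightarrow> twice_continuously_differentiable (\<lambda>(x, u). c k x u)"
    and "twice_continuously_differentiable cT"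
    and "\<And>\<theta> x. \<theta> \<in> \<Theta> \<Longrightarrow> \<mu> \<theta> x \<in> A"
    and "\<And>\<theta>. \<theta> \<in> \<Theta> \<Longrightarrow> bounded (range (\<mu> \<theta>))"
    and "\<And>\<epsilon>. \<epsilon> > 0 \<Longrightarrow> \<exists>\<delta>>0. \<forall>\<theta>\<in>\<Theta>. \<forall>\<theta>'\<in>\<Theta>. norm (\<theta> - \<theta>') < \<delta> \<longrightarrow>
           (SUP x. norm (\<mu> \<theta> x - \<mu> \<theta>' x)) < \<epsilon>"
    and "local_minimizer_DP n f c cT \<Theta> \<mu> \<pi>"
  shows "local_minimizer_one_shot n f c cT \<Theta> \<mu> x0 \<pi>"
proof -
  obtain \<epsilon> where \<epsilon>: "\<epsilon> > 0"
    "\<And>k x \<theta>. k < n \<Longrightarrow> \<theta> \<in> ball (\<pi> k) \<epsilon> \<inter> \<Theta> \<Longrightarrow>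
      Q_value n f c cT \<mu> \<pi> k x (\<mu> (\<pi> k) x) \<le> Q_value n f c cT \<mu> \<pi> k x (\<mu> \<theta> x)"
    using local_minimizer_DP_uniform_radius[OF assms(8)] by metis
  have "cost_to_go n f c cT \<mu> \<pi> 0 x0 \<le> cost_to_go n f c cT \<mu> \<pi>' 0 x0"
    if "\<pi>' \<in> (\<Pi>\<^sub>E k\<in>{..<n}. ball (\<pi> k) \<epsilon> \<inter> \<Theta>)" for \<pi>'
  proof (rule cost_to_go_mono_policy)
    \<comment> \<open>Membership in the product set is componentwise, so each
      \<open>\<pi>' k\<close> lies within the common radius of \<open>\<pi> k\<close>.\<close>
    fix k x assume "k < n"
    with that have "\<pi>' k \<in> ball (\<pi> k) \<epsilon> \<inter> \<Theta>"
      by (meson PiE_mem lessThan_iff)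
    with \<open>k < n\<close> show "Q_value n f c cT \<mu> \<pi> k x (\<mu> (\<pi> k) x)
        \<le> Q_value n f c cT \<mu> \<pi> k x (\<mu> (\<pi>' k) x)"
      by (rule \<epsilon>(2))
  qed simp
  moreover have "\<pi> \<in> {..<n} \<rightarrow>\<^sub>E \<Theta>"
    using assms(8) by (simp add: local_minimizer_DP_def)
  ultimately show ?thesis
    using \<epsilon>(1) unfolding local_minimizer_one_shot_def by blast
qed

end
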